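(* Let $P_1, P_2 \in \mathcal{D}_{\geq 1} \cap M$. Assume there is some $x_0 \geq 1$ such that (i) for every Borel set $B \subseteq [x_0, \infty)$ we have $P_1(B) \leq P_2(B)$, and (ii) $P_1([x_0, \infty)) < P_2([x_0, \infty))$. Then $P_1 \prec_{\text{tail}} P_2$.
   Context: $\mathcal{D}$ is the set of Borel probability measures on $\mathbb{R}$; $\mathcal{D}_{\geq 1}$ is the subset of those whose support is contained in $[1,\infty)$. $M$ is the set of $P \in \mathcal{D}$ with $\int |x|^k \, dP(x) < \infty$ for all $k \in \mathbb{N}$; for $P\in M$ and $k \in \mathbb{N}_0$ let $m_k(P) = \int x^k \, dP(x)$. The stochastic tail order on $\mathcal{D}$ is defined by: $P_1 \preccurlyeq_{\text{tail}} P_2$ iff $P_1 = P_2$, or ($P_1, P_2 \in M$ and $m_k(P_1) \leq m_k(P_2)$ for all but finitely many $k \in \mathbb{N}_0$). $P_1 \prec_{\text{tail}} P_2$ means $P_1 \preccurlyeq_{\text{tail}} P_2$ and not $P_2 \preccurlyeq_{\text{tail}} P_1$. *)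

theory Defs
  imports "HOL-Probability.Probability"
begin

definition prob_dists :: "real measure set" where
  "prob_dists = {P. real_distribution P}"

definition supp :: "real measure \<Rightarrow> real set" where
  "supp P = {x. \<forall>U. open U \<longrightarrow> x \<in> U \<longrightarrow> measure P U > 0}"

definition prob_dists_ge1 :: "real measure set" where
  "prob_dists_ge1 = {P \<in> prob_dists. supp P \<subseteq> {1..}}"

definition finite_moment_dists :: "real measure set" where
  "finite_moment_dists = {P \<in> prob_dists. \<forall>k::nat. integrable P (\<lambda>x. \<bar>x\<bar> ^ k)}"

definition moment :: "nat \<Rightarrow> real measure \<Rightarrow> real" where
  "moment k P = (\<integral>x. x ^ k \<partial>P)"

text \<open>
  The order lives on \<^const>\<open>prob_dists\<close>, so the reflexive case is restricted to
  that set; \<open>\<forall>\<^sub>\<infinity>k\<close> is the quantifier "for all but finitely many".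
\<close>

definition tail_le :: "real measure \<Rightarrow> real measure \<Rightarrow> bool" (infix "\<preceq>tail" 50) where
  "P1 \<preceq>tail P2 \<longleftrightarrow> P1 \<in> prob_dists \<and> P2 \<in> prob_dists \<and>
     (P1 = P2 \<or>
      (P1 \<in> finite_moment_dists \<and> P2 \<in> finite_moment_dists \<and>
       (\<forall>\<^sub>\<infinity>k. moment k P1 \<le> moment k P2)))"

definition tail_less :: "real measure \<Rightarrow> real measure \<Rightarrow> bool" (infix "\<prec>tail" 50) where
  "P1 \<prec>tail P2 \<longleftrightarrow> P1 \<preceq>tail P2 \<and> \<not> P2 \<preceq>tail P1"

end

theory Submission
  imports Defs
begin

text \<open>
  Write \<open>\<delta> = P2[x0, \<infinity>) - P1[x0, \<infinity>) > 0\<close>. Since \<open>P2 - P1\<close> is a nonnegative measure of mass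
  \<open>\<delta>\<close> on \<open>[x0, \<infinity>)\<close>, the part of the moments above \<open>x0\<close> contributes at least \<open>x0^k * \<delta>\<close> to
  \<open>moment k P2 - moment k P1\<close>. By dominated convergence, the part of \<open>moment k P1\<close> below \<open>x0\<close> is
  \<open>o(x0^k)\<close>, so the difference is eventually positive.
\<close>

text \<open>A point outside the support has an open null neighbourhood, and by Lindelof countably
  many such neighbourhoods already cover the complement, which is therefore null. This turns a bound
  on the support into an almost sure bound on \<open>x\<close>.\<close>

lemma (in real_distribution) AE_in_supp: "AE x in M. x \<in> supp M"
proof -
  define F where "F = {U::real set. open U \<and> measure M U = 0}"
  obtain F' where F': "F' \<subseteq> F" "countable F'" "\<Union>F' = \<Union>F"
    using Lindelof[of F] unfolding F_def by auto
  have "(\<Union>U\<in>F'. U) \<in> null_sets M"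
  proof (rule null_sets_UN'[OF F'(2)])
    fix U assume "U \<in> F'"
    then have "open U" "measure M U = 0"
      using F'(1) by (auto simp: F_def)
    then show "U \<in> null_sets M"
      by (auto simp: null_sets_def emeasure_eq_measure)
  qed
  moreover have "{x \<in> space M. x \<notin> supp M} \<subseteq> (\<Union>U\<in>F'. U)"
    using F'(3) by (auto simp: supp_def F_def zero_less_measure_iff)
  ultimately show ?thesis
    by (rule AE_I')
qed

text \<open>Weighting both measures by \<open>indicator A\<close> turns the setwise hypothesis,
  known only inside \<open>A\<close>, into an inequality in the order on measures, under which
  nonnegative integrals are monotone.\<close>

lemma set_lebesgue_integral_mono_measure:
  fixes f :: "'a \<Rightarrow> real"
  assumes sets: "sets M = sets N"
    and A: "A \<in> sets N"
    and le: "\<And>B. B \<in> sets N \<Longrightarrow> B \<subseteq> A \<Longrightarrow> emeasure M B \<le> emeasure N B"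
    and nonneg: "\<And>x. x \<in> A \<Longrightarrow> 0 \<le> f x"
    and int: "set_integrable N A f"
  shows "(LINT x:A|M. f x) \<le> (LINT x:A|N. f x)"
proof -
  define g where "g = (\<lambda>x. indicator A x *\<^sub>R f x)"
  have g_int: "integrable N g"
    using int by (simp add: set_integrable_def g_def)
  then have g_meas [measurable]: "g \<in> borel_measurable N"
    by auto
  have g_measM: "g \<in> borel_measurable M"
    using g_meas by (simp add: measurable_cong_sets[OF sets refl])
  have g_nonneg: "0 \<le> g x" for x
    using nonneg by (auto simp: g_def indicator_def)
  \<comment> \<open>\<open>g\<close> already vanishes off \<open>A\<close>, so the weight does not
    change its integral.\<close>
  have ind_g: "indicator A x * ennreal (g x) = ennreal (g x)" for x
    by (simp add: g_def indicator_def)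
  have AM: "A \<in> sets M"
    using A sets by simp
  have "density M (indicator A) \<le> density N (indicator A)"
  proof (subst le_measure)
    show "\<forall>B\<in>sets (density M (indicator A)).
        emeasure (density M (indicator A)) B \<le> emeasure (density N (indicator A)) B"
    proof
      fix B assume "B \<in> sets (density M (indicator A))"
      then have "B \<in> sets N"
        using sets by simp
      then show "emeasure (density M (indicator A)) B \<le> emeasure (density N (indicator A)) B"
        using A AM le[of "A \<inter> B"] sets by (simp add: emeasure_restricted)
    qed
  qed (simp add: sets)
  then have "(\<integral>\<^sup>+x. ennreal (g x) \<partial>density M (indicator A))
      \<le> (\<integral>\<^sup>+x. ennreal (g x) \<partial>density N (indicator A))"
    by (rule nn_integral_mono_measure[rotated]) (simp add: sets)
  moreover have "(\<integral>\<^sup>+x. ennreal (g x) \<partial>density N (indicator A)) = (\<integral>\<^sup>+x. ennreal (g x) \<partial>N)"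
    using A g_meas by (simp add: nn_integral_density ind_g)
  moreover have "(\<integral>\<^sup>+x. ennreal (g x) \<partial>density M (indicator A)) = (\<integral>\<^sup>+x. ennreal (g x) \<partial>M)"
    using AM g_measM by (simp add: nn_integral_density ind_g)
  ultimately have "(\<integral>\<^sup>+x. ennreal (g x) \<partial>M) \<le> (\<integral>\<^sup>+x. ennreal (g x) \<partial>N)"
    by simp
  \<comment> \<open>Finiteness is essential for returning to real integrals: \<open>enn2real\<close>
    sends \<open>top\<close> to 0, so it is monotone only below a finite bound.\<close>
  moreover have "(\<integral>\<^sup>+x. ennreal (g x) \<partial>N) < top"
    using g_int g_nonneg by (simp add: nn_integral_eq_integral)
  ultimately have "integral\<^sup>L M g \<le> integral\<^sup>L N g"
    using g_measM g_meas g_nonneg by (simp add: integral_eq_nn_integral enn2real_mono)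
  then show ?thesis
    by (simp add: set_lebesgue_integral_def g_def)
qed

text \<open>For \<open>0 \<le> x < c\<close> the powers of \<open>x / c\<close> tend to 0 and stay
  below 1, and the constant 1 is integrable. The interval is open at \<open>c\<close> because an
  atom there would contribute its full mass for every \<open>k\<close>.\<close>

lemma (in real_distribution) truncated_moment_small:
  assumes c: "c > 0" and nonneg: "AE x in M. 0 \<le> x"
  shows "(\<lambda>k. (LINT x:{..<c}|M. x ^ k) / c ^ k) \<longlonglongrightarrow> 0"
proof -
  have "(\<lambda>k. LINT x|M. indicator {..<c} x * (x / c) ^ k) \<longlonglongrightarrow> (LINT x|M. 0)"
  proof (rule integral_dominated_convergence)
    show "integrable M (\<lambda>_. 1 :: real)"
      by simp
    show "AE x in M. (\<lambda>k. indicator {..<c} x * (x / c) ^ k) \<longlonglongrightarrow> 0"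
      using nonneg
    proof eventually_elim
      case (elim x)
      then show ?case
        using c by (cases "x < c") (auto intro!: LIMSEQ_power_zero)
    qed
    show "AE x in M. norm (indicator {..<c} x * (x / c) ^ k) \<le> 1" for k
      using nonneg
    proof eventually_elim
      case (elim x)
      then show ?case
        using c by (cases "x < c") (auto intro!: power_le_one)
    qed
  qed auto
  moreover have "(LINT x|M. indicator {..<c} x * (x / c) ^ k) = (LINT x:{..<c}|M. x ^ k) / c ^ k" for k
    by (simp add: set_lebesgue_integral_def power_divide flip: integral_divide_zero)
  ultimately show ?thesis
    by simp
qed

text \<open>Subtracting \<open>c ^ k\<close> on the tail isolates the term
  \<open>c ^ k * measure P {c..}\<close>, where the gap in mass appears, and for
  \<open>c \<ge> 0\<close> leaves a nonnegative integrand to which the comparison of measures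
  applies.\<close>

lemma moment_split:
  assumes "P \<in> finite_moment_dists"
  shows "moment k P = (LINT x:{..<c}|P. x ^ k) + (LINT x:{c..}|P. x ^ k - c ^ k)
           + c ^ k * measure P {c..}"
    and "set_integrable P {c..} (\<lambda>x. x ^ k - c ^ k)"
proof -
  interpret real_distribution P
    using assms by (simp add: finite_moment_dists_def prob_dists_def)
  have "integrable P (\<lambda>x. \<bar>x\<bar> ^ k)"
    using assms by (simp add: finite_moment_dists_def)
  then have "integrable P (\<lambda>x. x ^ k)"
    by (subst integrable_norm_iff[symmetric]) (auto simp: power_abs)
  then have int: "set_integrable P A (\<lambda>x. x ^ k)" if "A \<in> sets borel" for A
    using that unfolding set_integrable_def by (intro integrable_mult_indicator) auto
  have const: "set_integrable P {c..} (\<lambda>_. c ^ k)"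
    unfolding set_integrable_def by (intro integrable_mult_indicator) auto
  show "set_integrable P {c..} (\<lambda>x. x ^ k - c ^ k)"
    by (intro set_integral_diff int const) simp
  have "{..<c} \<union> {c..} = UNIV"
    by auto
  then have "moment k P = (LINT x:{..<c} \<union> {c..}|P. x ^ k)"
    by (simp add: moment_def set_lebesgue_integral_def)
  also have "\<dots> = (LINT x:{..<c}|P. x ^ k) + (LINT x:{c..}|P. x ^ k)"
    by (intro set_integral_Un int) auto
  also have "(LINT x:{c..}|P. x ^ k) = (LINT x:{c..}|P. x ^ k - c ^ k) + c ^ k * measure P {c..}"
    using set_integral_diff(2)[OF int const]
    by (simp add: set_lebesgue_integral_def)
  finally show "moment k P = (LINT x:{..<c}|P. x ^ k) + (LINT x:{c..}|P. x ^ k - c ^ k)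
      + c ^ k * measure P {c..}"
    by simp
qed

theorem theorem4p16:
  fixes P1 P2 :: "real measure"
  assumes "P1 \<in> prob_dists_ge1 \<inter> finite_moment_dists"
    and "P2 \<in> prob_dists_ge1 \<inter> finite_moment_dists"
    and "\<exists>x0::real. x0 \<ge> 1 \<and>
           (\<forall>B \<in> sets borel. B \<subseteq> {x0..} \<longrightarrow> measure P1 B \<le> measure P2 B) \<and>
           measure P1 {x0..} < measure P2 {x0..}"
  shows "P1 \<prec>tail P2"
proof -
  obtain c where c: "c \<ge> 1"
    and le: "\<And>B. B \<in> sets borel \<Longrightarrow> B \<subseteq> {c..} \<Longrightarrow> measure P1 B \<le> measure P2 B"
    and less: "measure P1 {c..} < measure P2 {c..}"
    using assms(3) by blast
  interpret P1: real_distribution P1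
    using assms(1) by (simp add: prob_dists_ge1_def prob_dists_def)
  interpret P2: real_distribution P2
    using assms(2) by (simp add: prob_dists_ge1_def prob_dists_def)
  have nonneg1: "AE x in P1. 0 \<le> x"
    using P1.AE_in_supp by eventually_elim (use assms(1) in \<open>force simp: prob_dists_ge1_def\<close>)
  have nonneg2: "AE x in P2. 0 \<le> x"
    using P2.AE_in_supp by eventually_elim (use assms(2) in \<open>force simp: prob_dists_ge1_def\<close>)
  \<comment> \<open>The limit 0 lies strictly below the gap in tail mass, which is positive by
    \<open>less\<close>.\<close>
  have "\<forall>\<^sub>F k in sequentially. (LINT x:{..<c}|P1. x ^ k) / c ^ k < measure P2 {c..} - measure P1 {c..}"
    using c less by (intro order_tendstoD(2)[OF P1.truncated_moment_small] nonneg1) auto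
  then have ev: "\<forall>\<^sub>F k in sequentially. moment k P1 < moment k P2"
  proof eventually_elim
    case (elim k)
    have "(LINT x:{..<c}|P1. x ^ k) < c ^ k * (measure P2 {c..} - measure P1 {c..})"
      using elim c by (simp add: divide_less_eq mult.commute)
    moreover have "(LINT x:{c..}|P1. x ^ k - c ^ k) \<le> (LINT x:{c..}|P2. x ^ k - c ^ k)"
      using c le assms(2)
      by (intro set_lebesgue_integral_mono_measure moment_split(2))
        (auto simp: P1.emeasure_eq_measure P2.emeasure_eq_measure intro!: power_mono)
    \<comment> \<open>For \<open>P2\<close> the sign of the part below \<open>c\<close> suffices: it
      can only enlarge \<open>moment k P2\<close>.\<close>
    moreover have "0 \<le> (LINT x:{..<c}|P2. x ^ k)"
      unfolding set_lebesgue_integral_def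
      by (rule integral_nonneg_AE) (use nonneg2 in eventually_elim, auto)
    ultimately show ?case
      using moment_split(1)[of P1 k c] moment_split(1)[of P2 k c] assms(1,2)
      by (simp add: right_diff_distrib)
  qed
  have "\<forall>\<^sub>F k in sequentially. moment k P1 \<le> moment k P2"
    using ev by eventually_elim simp
  then have "P1 \<preceq>tail P2"
    using assms(1,2) by (auto simp: tail_le_def prob_dists_ge1_def cofinite_eq_sequentially)
  moreover have "\<not> P2 \<preceq>tail P1"
  proof
    assume "P2 \<preceq>tail P1"
    \<comment> \<open>Unequal tail masses exclude the reflexive case of \<open>tail_le\<close>, so
      only the comparison of moments remains, and it contradicts \<open>ev\<close>.\<close>
    moreover have "P2 \<noteq> P1"
      using less by auto
    ultimately have "\<forall>\<^sub>F k in sequentially. moment k P2 \<le> moment k P1"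
      by (simp add: tail_le_def cofinite_eq_sequentially)
    with ev have "\<forall>\<^sub>F k::nat in sequentially. False"
      by eventually_elim simp
    then show False
      by simp
  qed
  ultimately show ?thesis
    by (simp add: tail_less_def)
qed

end
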